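(* For every finite undirected graph $G$, $$i_g(G) \le \left\lfloor\frac{3\Delta(G) - a(G)}{2}\right\rfloor + 8a(G) - 1,$$ where $\Delta(G)$ is the maximum degree of $G$, $a(G)$ is the arboricity of $G$, and $i_g(G)$ is the incidence game chromatic number of $G$.
   Context: An incidence of a graph $G$ is a pair $(v,e)$ where $v$ is a vertex of $G$ and $e$ is an edge of $G$ incident to $v$. Two incidences $(v,e)$ and $(w,f)$ are adjacent if $v=w$, or $e=f$, or the edge $vw$ equals $e$ or $f$. An incidence coloring assigns colors to incidences so that adjacent incidences get distinct colors. The incidence coloring game on $G$ with a given set of $k$ colors: two players, Alice and Bob, alternately color an uncolored incidence of $G$ (Alice moves first) with one of the $k$ colors, so that the partial coloring always remains a proper incidence coloring. Alice wins if eventually all incidences of $G$ are colored; otherwise (i.e. if at some point some uncolored incidence has no legal color) Bob wins. The incidence game chromatic number $i_g(G)$ is the smallest $k$ for which Alice has a winning strategy. The arboricity $a(G)$ is the minimum number of forests into which the edge set of $G$ can be partitioned.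
   Formalization: The graph is assumed to have at least one edge: for an edgeless graph the maximum degree and arboricity are 0, so the claimed bound is -1, while the incidence game chromatic number is 0. *)

theory Defs
  imports Complex_Main
begin

definition simple_graph :: "'a set \<Rightarrow> 'a set set \<Rightarrow> bool" where
  "simple_graph V E \<longleftrightarrow> finite V \<and> (\<forall>e\<in>E. e \<subseteq> V \<and> card e = 2)"

definition degree :: "'a set set \<Rightarrow> 'a \<Rightarrow> nat" where
  "degree E v = card {e\<in>E. v \<in> e}"

definition max_degree :: "'a set \<Rightarrow> 'a set set \<Rightarrow> nat" where
  "max_degree V E = Max (degree E ` V)"

definition is_cycle :: "'a set set \<Rightarrow> 'a list \<Rightarrow> bool" where
  "is_cycle F vs \<longleftrightarrow> length vs \<ge> 3 \<and> distinct vs \<and>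
     (\<forall>i < length vs. {vs ! i, vs ! ((i + 1) mod length vs)} \<in> F)"

definition forest :: "'a set set \<Rightarrow> bool" where
  "forest F \<longleftrightarrow> \<not> (\<exists>vs. is_cycle F vs)"

definition arboricity :: "'a set set \<Rightarrow> nat" where
  "arboricity E = (LEAST k. \<exists>f :: 'a set \<Rightarrow> nat.
      (\<forall>e\<in>E. f e < k) \<and> (\<forall>j<k. forest {e\<in>E. f e = j}))"

definition incidences :: "'a set set \<Rightarrow> ('a \<times> 'a set) set" where
  "incidences E = {(v, e). e \<in> E \<and> v \<in> e}"

definition inc_adj :: "('a \<times> 'a set) \<Rightarrow> ('a \<times> 'a set) \<Rightarrow> bool" where
  "inc_adj i j \<longleftrightarrow> i \<noteq> j \<and>
     (fst i = fst j \<or> snd i = snd j \<or> snd i = {fst i, fst j} \<or> snd j = {fst i, fst j})"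

definition legal_move :: "'a set set \<Rightarrow> nat \<Rightarrow> ('a \<times> 'a set \<Rightarrow> nat option)
    \<Rightarrow> ('a \<times> 'a set) \<Rightarrow> nat \<Rightarrow> bool" where
  "legal_move E k c i \<alpha> \<longleftrightarrow> i \<in> incidences E \<and> c i = None \<and> \<alpha> < k \<and>
     (\<forall>j. inc_adj i j \<longrightarrow> c j \<noteq> Some \<alpha>)"

definition no_blocked :: "'a set set \<Rightarrow> nat \<Rightarrow> ('a \<times> 'a set \<Rightarrow> nat option) \<Rightarrow> bool" where
  "no_blocked E k c \<longleftrightarrow> (\<forall>i\<in>incidences E. c i = None \<longrightarrow> (\<exists>\<alpha>. legal_move E k c i \<alpha>))"

definition num_colored :: "'a set set \<Rightarrow> ('a \<times> 'a set \<Rightarrow> nat option) \<Rightarrow> nat" where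
  "num_colored E c = card {i\<in>incidences E. c i \<noteq> None}"

text \<open>alice_wins E k c: from the partial colouring c (reached from the empty colouring
  by legal moves), Alice has a winning strategy. Whose turn it is is determined by the
  parity of the number of coloured incidences (Alice moves first).\<close>
inductive alice_wins :: "'a set set \<Rightarrow> nat \<Rightarrow> ('a \<times> 'a set \<Rightarrow> nat option) \<Rightarrow> bool"
  for E k where
  finished: "(\<forall>i\<in>incidences E. c i \<noteq> None) \<Longrightarrow> alice_wins E k c"
| alice_turn: "even (num_colored E c) \<Longrightarrow> no_blocked E k c \<Longrightarrow> legal_move E k c i \<alpha> \<Longrightarrow>
     alice_wins E k (c(i := Some \<alpha>)) \<Longrightarrow> alice_wins E k c"
| bob_turn: "odd (num_colored E c) \<Longrightarrow> (\<exists>i\<in>incidences E. c i = None) \<Longrightarrow> no_blocked E k c \<Longrightarrow>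
     (\<forall>i \<alpha>. legal_move E k c i \<alpha> \<longrightarrow> alice_wins E k (c(i := Some \<alpha>))) \<Longrightarrow> alice_wins E k c"

definition incidence_game_chromatic :: "'a set set \<Rightarrow> nat" where
  "incidence_game_chromatic E = (LEAST k. alice_wins E k (\<lambda>_. None))"

end

theory Submission
  imports Defs
begin

text \<open>
  Orient every forest of an optimal partition so that each vertex has in-degree at most one; then
  the whole graph has in-degrees at most a = a(G). An edge e = uv oriented from u to v has the top
  incidence (u, e) and the down incidence (v, e). Alice plays an activation strategy: each time an
  out-edge of v becomes active or is coloured by Bob, she works on an in-edge of v, first on those
  with an uncoloured down incidence (activating the edge and climbing on to its tail, or colouring
  the down incidence if the edge is already active), then on uncoloured top incidences. So at most
  2a out-edges of v are active while some in-edge has an uncoloured down incidence, and at most 3a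
  while some in-edge has an uncoloured incidence at all.

  Down incidences of two edges leaving the same vertex u are not adjacent, and as soon as 6a - 1
  colours occur on such incidences, any further one can be coloured by one of those colours. Once
  all in-edges of u are coloured, Alice answers every move of Bob on an out-edge of u by such a
  thrifty colouring, so only about half of the down incidences of edges leaving u contribute a new
  colour. This bounds the number of colours forbidden for a top incidence.
\<close>

section \<open>Proper partial colourings\<close>

lemma inc_adj_sym: "inc_adj i j \<Longrightarrow> inc_adj j i"
  unfolding inc_adj_def by (auto simp: insert_commute)

definition proper_coloring :: "('a \<times> 'a set \<Rightarrow> nat option) \<Rightarrow> bool" where
  "proper_coloring c \<longleftrightarrow> (\<forall>i j. inc_adj i j \<longrightarrow> c i \<noteq> None \<longrightarrow> c i \<noteq> c j)"

lemma proper_coloring_update: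
  assumes "proper_coloring c" "legal_move E k c i \<alpha>"
  shows "proper_coloring (c(i := Some \<alpha>))"
proof -
  have "\<And>j. inc_adj i j \<Longrightarrow> c j \<noteq> Some \<alpha>" "\<And>j. inc_adj j i \<Longrightarrow> c j \<noteq> Some \<alpha>"
    using assms(2) inc_adj_sym unfolding legal_move_def by blast+
  moreover have "\<not> inc_adj i i" by (simp add: inc_adj_def)
  ultimately show ?thesis
    using assms(1) unfolding proper_coloring_def by (metis fun_upd_other fun_upd_same)
qed

text \<open>Pigeonhole over the \<open>k\<close> colours. The set \<open>X\<close> consists of
  options so that it can be an image under \<open>c\<close>; a stray \<open>None\<close> in it does
  no harm.\<close>

lemma legal_move_if_few_forbidden:
  assumes "i \<in> incidences E" "c i = None" "finite X" "card X < k"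
    and X: "\<And>j. inc_adj i j \<Longrightarrow> c j \<noteq> None \<Longrightarrow> c j \<in> X"
  shows "\<exists>\<alpha>. legal_move E k c i \<alpha>"
proof -
  have "\<not> Some ` {..<k} \<subseteq> X"
  proof
    assume "Some ` {..<k} \<subseteq> X"
    then have "card (Some ` {..<k}) \<le> card X" using assms(3) by (rule card_mono[rotated])
    then show False using assms(4) by (simp add: card_image)
  qed
  then obtain \<alpha> where "\<alpha> < k" "Some \<alpha> \<notin> X" by auto
  then have "legal_move E k c i \<alpha>"
    unfolding legal_move_def using assms(1,2) X by fastforce
  then show ?thesis by blast
qed

section \<open>Orientations of bounded in-degree\<close>

text \<open>The assumption \<open>K_large\<close> is the bound of the theorem with the floor
  cleared; the count for uncoloured top incidences uses it up exactly.\<close>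

locale bounded_orientation =
  fixes E :: "'a set set" and head tail :: "'a set \<Rightarrow> 'a" and a \<Delta> K :: nat
  assumes finite_E: "finite E"
    and edge_eq: "e \<in> E \<Longrightarrow> e = {tail e, head e}"
    and tail_neq_head: "e \<in> E \<Longrightarrow> tail e \<noteq> head e"
    and indegree: "card {e \<in> E. head e = v} \<le> a"
    and degree: "card {e \<in> E. v \<in> e} \<le> \<Delta>"
    and a_pos: "1 \<le> a"
    and K_large: "3 * \<Delta> + 15 * a \<le> 2 * K + 3"
begin

definition ins :: "'a \<Rightarrow> 'a set set" where "ins v = {e \<in> E. head e = v}"
definition outs :: "'a \<Rightarrow> 'a set set" where "outs v = {e \<in> E. tail e = v}"
definition dn :: "'a set \<Rightarrow> 'a \<times> 'a set" where "dn e = (head e, e)"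
definition tp :: "'a set \<Rightarrow> 'a \<times> 'a set" where "tp e = (tail e, e)"

lemma finite_ins [simp]: "finite (ins v)" and finite_outs [simp]: "finite (outs v)"
  using finite_E by (auto simp: ins_def outs_def)

lemma dn_eq_iff [simp]: "dn e = dn f \<longleftrightarrow> e = f" and tp_eq_iff [simp]: "tp e = tp f \<longleftrightarrow> e = f"
  by (auto simp: dn_def tp_def)

lemma dn_neq_tp: "e \<in> E \<Longrightarrow> dn e \<noteq> tp f" "e \<in> E \<Longrightarrow> tp f \<noteq> dn e"
  using tail_neq_head[of e] by (auto simp: dn_def tp_def)

lemma incidences_eq: "incidences E = dn ` E \<union> tp ` E"
proof -
  have "v = tail e \<or> v = head e" if "e \<in> E" "v \<in> e" for v e
    using edge_eq[OF that(1)] that(2) by blast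
  moreover have "tail e \<in> e" "head e \<in> e" if "e \<in> E" for e
    using edge_eq[OF that] by blast+
  ultimately show ?thesis
    unfolding incidences_def dn_def tp_def by (auto simp: image_iff)
qed

lemma finite_incidences: "finite (incidences E)"
  using finite_E by (simp add: incidences_eq)

lemma incidence_cases:
  assumes "i \<in> incidences E"
  obtains (dn) e where "e \<in> E" "i = dn e" | (tp) e where "e \<in> E" "i = tp e"
  using assms unfolding incidences_eq by blast

lemma card_ins: "card (ins v) \<le> a"
  using indegree by (simp add: ins_def)

lemma card_outs_ins: "card (outs v) + card (ins v) \<le> \<Delta>"
proof -
  have "outs v \<inter> ins v = {}" using tail_neq_head by (fastforce simp: outs_def ins_def)
  then have "card (outs v) + card (ins v) = card (outs v \<union> ins v)" by (simp add: card_Un_disjoint)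
  also have "\<dots> \<le> card {e \<in> E. v \<in> e}"
    using finite_E edge_eq by (intro card_mono) (auto simp: outs_def ins_def)
  finally show ?thesis using degree[of v] by simp
qed

lemma edge_eqD: "e \<in> E \<Longrightarrow> e = {x, y} \<Longrightarrow> (x = tail e \<and> y = head e) \<or> (x = head e \<and> y = tail e)"
  using edge_eq[of e] by (metis doubleton_eq_iff)

text \<open>The first two sets lie on the tail side, the others on the head side. The down
  incidences of the siblings of \<open>e\<close> are missing, so out-edges of one vertex may share a
  colour there.\<close>

lemma adj_dn:
  assumes "e \<in> E" "j \<in> incidences E" "inc_adj (dn e) j"
  shows "j \<in> tp ` outs (tail e) \<union> dn ` ins (tail e) \<union> dn ` (ins (head e) - {e}) \<union>
    tp ` (ins (head e) - {e}) \<union> tp ` outs (head e) \<union> dn ` outs (head e)"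
  using assms(2)
proof (cases rule: incidence_cases)
  case (dn f)
  then have "f \<noteq> e" "head e = head f \<or> e = {head e, head f} \<or> f = {head e, head f}"
    using assms(3) by (auto simp: inc_adj_def dn_def)
  then have "head e = head f \<or> head f = tail e \<or> tail f = head e"
    using edge_eqD[OF assms(1)] edge_eqD[OF dn(1)] tail_neq_head[OF dn(1)] tail_neq_head[OF assms(1)]
    by metis
  then show ?thesis using dn \<open>f \<noteq> e\<close> by (auto simp: ins_def outs_def)
next
  case (tp f)
  then have "head e = tail f \<or> e = f \<or> e = {head e, tail f} \<or> f = {head e, tail f}"
    using assms(3) by (auto simp: inc_adj_def dn_def tp_def)
  then have "tail f = head e \<or> tail f = tail e \<or> (head f = head e \<and> f \<noteq> e)"
    using edge_eqD[OF assms(1)] edge_eqD[OF tp(1)] tail_neq_head[OF tp(1)] tail_neq_head[OF assms(1)]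
    by metis
  then show ?thesis using tp by (auto simp: ins_def outs_def)
qed

text \<open>Here the down incidences of all out-edges of \<open>tail e\<close> do occur. This is why
  the number of distinct colours on them has to be kept small.\<close>

lemma adj_tp:
  assumes "e \<in> E" "j \<in> incidences E" "inc_adj (tp e) j"
  shows "j \<in> tp ` (outs (tail e) - {e}) \<union> dn ` ins (tail e) \<union> tp ` ins (tail e) \<union>
    dn ` outs (tail e) \<union> tp ` outs (head e) \<union> dn ` (ins (head e) - {e})"
  using assms(2)
proof (cases rule: incidence_cases)
  case (dn f)
  then have "tail e = head f \<or> e = f \<or> e = {tail e, head f} \<or> f = {tail e, head f}"
    using assms(3) by (auto simp: inc_adj_def dn_def tp_def)
  then have "head f = tail e \<or> tail f = tail e \<or> (head f = head e \<and> f \<noteq> e)"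
    using edge_eqD[OF assms(1)] edge_eqD[OF dn(1)] tail_neq_head[OF dn(1)] tail_neq_head[OF assms(1)]
    by metis
  then show ?thesis using dn by (auto simp: ins_def outs_def)
next
  case (tp f)
  then have "f \<noteq> e" "tail e = tail f \<or> e = {tail e, tail f} \<or> f = {tail e, tail f}"
    using assms(3) by (auto simp: inc_adj_def tp_def)
  then have "(tail f = tail e) \<or> tail f = head e \<or> head f = tail e"
    using edge_eqD[OF assms(1)] edge_eqD[OF tp(1)] tail_neq_head[OF tp(1)] tail_neq_head[OF assms(1)]
    by metis
  then show ?thesis using tp \<open>f \<noteq> e\<close> by (auto simp: ins_def outs_def)
qed

text \<open>With the next lemma: the neighbours of a down incidence on the tail side depend only on
  the tail, so a colour used on one sibling meets no conflict there on another.\<close>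

lemma adj_dn_dn_parent: "e \<in> outs u \<Longrightarrow> f \<in> ins u \<Longrightarrow> inc_adj (dn e) (dn f)"
  using edge_eq[of e] tail_neq_head[of e] by (auto simp: inc_adj_def dn_def outs_def ins_def insert_commute)

lemma adj_dn_tp_sibling: "e \<in> outs u \<Longrightarrow> f \<in> outs u \<Longrightarrow> inc_adj (dn e) (tp f)"
  using edge_eq[of e] tail_neq_head[of e] by (auto simp: inc_adj_def dn_def tp_def outs_def insert_commute)

section \<open>Invariants of the game\<close>

definition dn_col :: "('a \<times> 'a set \<Rightarrow> nat option) \<Rightarrow> 'a set set" where
  "dn_col c = {e \<in> E. c (dn e) \<noteq> None}"
definition tp_col :: "('a \<times> 'a set \<Rightarrow> nat option) \<Rightarrow> 'a set set" where
  "tp_col c = {e \<in> E. c (tp e) \<noteq> None}"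

definition dn_colors :: "('a \<times> 'a set \<Rightarrow> nat option) \<Rightarrow> 'a \<Rightarrow> nat option set" where
  "dn_colors c v = (\<lambda>e. c (dn e)) ` (outs v \<inter> dn_col c)"

lemma dn_colors_le: "card (dn_colors c v) \<le> card (outs v \<inter> dn_col c)"
  unfolding dn_colors_def by (rule card_image_le) simp

lemma finite_dn_colors [simp]: "finite (dn_colors c v)"
  by (simp add: dn_colors_def)

lemma finite_dn_col [simp]: "finite (dn_col c)" "finite (tp_col c)"
  using finite_E by (auto simp: dn_col_def tp_col_def)

definition base_inv :: "('a \<times> 'a set \<Rightarrow> nat option) \<Rightarrow> 'a set set \<Rightarrow> bool" where
  "base_inv c A \<longleftrightarrow> A \<subseteq> E \<and> dn_col c \<subseteq> A \<and> tp_col c \<subseteq> A \<and>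
     (\<forall>i. c i \<noteq> None \<longrightarrow> i \<in> incidences E) \<and> (\<forall>i \<alpha>. c i = Some \<alpha> \<longrightarrow> \<alpha> < K) \<and> proper_coloring c"

text \<open>The active edges A contain all edges with a coloured incidence. The right-hand sides count
  the reactions at v that Alice has made or that Bob has saved her.\<close>

definition in_inv :: "('a \<times> 'a set \<Rightarrow> nat option) \<Rightarrow> 'a set set \<Rightarrow> nat \<Rightarrow> 'a \<Rightarrow> bool" where
  "in_inv c A s v \<longleftrightarrow>
     (\<not> ins v \<subseteq> dn_col c \<longrightarrow>
        card (outs v \<inter> A) \<le> card (ins v \<inter> A) + card (ins v \<inter> dn_col c) + s) \<and>
     (\<not> ins v \<subseteq> dn_col c \<inter> tp_col c \<longrightarrow>
        card (outs v \<inter> A)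
          \<le> card (ins v \<inter> A) + card (ins v \<inter> dn_col c) + card (ins v \<inter> tp_col c) + s)"

text \<open>The exceptional 1 is for Bob taking the last down incidence below v, to which Alice has no
  reply there.\<close>

definition color_inv :: "('a \<times> 'a set \<Rightarrow> nat option) \<Rightarrow> nat \<Rightarrow> 'a \<Rightarrow> bool" where
  "color_inv c s v \<longleftrightarrow>
     2 * card (dn_colors c v) \<le> 6 * a - 1 + card (outs v \<inter> dn_col c) +
        (if outs v \<subseteq> dn_col c then 1 else s)"

text \<open>The slack of 1 is at the vertex v to which Alice still has to react.\<close>

definition inv_except :: "('a \<times> 'a set \<Rightarrow> nat option) \<Rightarrow> 'a set set \<Rightarrow> 'a \<Rightarrow> bool" where
  "inv_except c A v \<longleftrightarrow> base_inv c A \<and>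
     (\<forall>w. in_inv c A (of_bool (w = v)) w \<and> color_inv c (of_bool (w = v)) w)"

text \<open>This is the position that Alice leaves to Bob: no vertex is owed a reaction.\<close>

definition inv_all :: "('a \<times> 'a set \<Rightarrow> nat option) \<Rightarrow> 'a set set \<Rightarrow> bool" where
  "inv_all c A \<longleftrightarrow> base_inv c A \<and> (\<forall>w. in_inv c A 0 w \<and> color_inv c 0 w)"

lemma in_inv_weaken: "in_inv c A s v \<Longrightarrow> s \<le> t \<Longrightarrow> in_inv c A t v"
  and color_inv_weaken: "color_inv c s v \<Longrightarrow> s \<le> t \<Longrightarrow> color_inv c t v"
  unfolding in_inv_def color_inv_def by (auto split: if_splits)

lemma inv_all_imp_except: "inv_all c A \<Longrightarrow> inv_except c A v"
  unfolding inv_all_def inv_except_def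
  using in_inv_weaken color_inv_weaken by (metis le0)

lemma inv_except_slack:
  assumes "inv_except c A v"
  shows "in_inv c A 1 w" "color_inv c 1 w"
  using assms in_inv_weaken[of c A "of_bool (w = v)" w 1] color_inv_weaken[of c "of_bool (w = v)" w 1]
  unfolding inv_except_def by auto

lemma dn_col_update:
  "e \<in> E \<Longrightarrow> dn_col (c(dn e := Some \<alpha>)) = insert e (dn_col c)"
  "e \<in> E \<Longrightarrow> dn_col (c(tp e := Some \<alpha>)) = dn_col c"
  "e \<in> E \<Longrightarrow> tp_col (c(dn e := Some \<alpha>)) = tp_col c"
  "e \<in> E \<Longrightarrow> tp_col (c(tp e := Some \<alpha>)) = insert e (tp_col c)"
  by (auto simp: dn_col_def tp_col_def dn_neq_tp)

lemma dn_colors_update_tp: "e \<in> E \<Longrightarrow> dn_colors (c(tp e := Some \<alpha>)) v = dn_colors c v"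
  unfolding dn_colors_def dn_col_update by (rule image_cong) (auto simp: dn_neq_tp dn_col_def)

lemma dn_colors_update_dn:
  assumes "e \<in> E" "c (dn e) = None"
  shows "dn_colors (c(dn e := Some \<alpha>)) v =
    (if v = tail e then insert (Some \<alpha>) (dn_colors c v) else dn_colors c v)"
proof -
  have "outs v \<inter> insert e (dn_col c) = (if v = tail e then insert e (outs v \<inter> dn_col c) else outs v \<inter> dn_col c)"
    using assms(1) by (auto simp: outs_def)
  moreover have "(\<lambda>f. (c(dn e := Some \<alpha>)) (dn f)) ` (outs v \<inter> dn_col c) = (\<lambda>f. c (dn f)) ` (outs v \<inter> dn_col c)"
    by (rule image_cong) (use assms(2) in \<open>auto simp: dn_col_def\<close>)
  ultimately show ?thesis using assms(1) by (auto simp: dn_colors_def dn_col_update)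
qed

lemma base_inv_activate: "base_inv c A \<Longrightarrow> e \<in> E \<Longrightarrow> base_inv c (insert e A)"
  by (auto simp: base_inv_def)

lemma base_inv_update:
  assumes "base_inv c A" "legal_move E K c i \<alpha>" "e \<in> E" "i = dn e \<or> i = tp e"
  shows "base_inv (c(i := Some \<alpha>)) (insert e A)"
proof -
  have "proper_coloring (c(i := Some \<alpha>))"
    using assms(1,2) proper_coloring_update unfolding base_inv_def by blast
  then show ?thesis
    using assms unfolding base_inv_def legal_move_def by (auto simp: dn_col_update)
qed

section \<open>Legal moves\<close>

text \<open>The uncoloured \<open>dn e\<close> makes the count of coloured down incidences strictly
  smaller than the in-degree, which absorbs the slack of 1.\<close>

lemma card_out_active_dn:
  assumes "inv_except c A u" "e \<in> E" "c (dn e) = None"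
  shows "card (outs (head e) \<inter> A) \<le> 2 * card (ins (head e))"
proof -
  let ?v = "head e"
  have e: "e \<in> ins ?v" "e \<notin> dn_col c" using assms by (auto simp: ins_def dn_col_def)
  then have "card (ins ?v \<inter> dn_col c) < card (ins ?v)" by (intro psubset_card_mono) auto
  moreover have "card (ins ?v \<inter> A) \<le> card (ins ?v)" by (intro card_mono) auto
  moreover have "in_inv c A 1 ?v" using assms(1) by (rule inv_except_slack)
  ultimately show ?thesis using e unfolding in_inv_def by auto
qed

lemma card_out_active_incomplete:
  assumes "in_inv c A 1 v" "\<not> ins v \<subseteq> dn_col c \<inter> tp_col c"
  shows "card (outs v \<inter> A) \<le> 3 * card (ins v)"
proof -
  have "card (ins v \<inter> A) \<le> card (ins v)" "card (ins v \<inter> dn_col c) \<le> card (ins v)"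
    "card (ins v \<inter> tp_col c) \<le> card (ins v)" by (auto intro: card_mono)
  moreover have "card (ins v \<inter> dn_col c) < card (ins v) \<or> card (ins v \<inter> tp_col c) < card (ins v)"
  proof -
    have "ins v \<inter> dn_col c \<subset> ins v \<or> ins v \<inter> tp_col c \<subset> ins v" using assms(2) by blast
    then show ?thesis using psubset_card_mono[OF finite_ins] by blast
  qed
  ultimately show ?thesis using assms unfolding in_inv_def by auto
qed

lemma card_out_active_tp:
  assumes "inv_except c A u" "e \<in> E" "c (tp e) = None"
  shows "card (outs (head e) \<inter> A) \<le> 3 * card (ins (head e))"
proof (rule card_out_active_incomplete)
  show "in_inv c A 1 (head e)" using assms(1) by (rule inv_except_slack)
  show "\<not> ins (head e) \<subseteq> dn_col c \<inter> tp_col c" using assms by (auto simp: ins_def tp_col_def)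
qed

text \<open>These neighbours of \<open>dn e\<close> at its head, on edges other than
  \<open>e\<close>, can carry a colour. Coloured edges are active, so only the out-edges in
  \<open>A\<close> matter.\<close>

definition head_side :: "'a set set \<Rightarrow> 'a set \<Rightarrow> ('a \<times> 'a set) set" where
  "head_side A e = dn ` (ins (head e) - {e}) \<union> tp ` (ins (head e) - {e}) \<union>
     tp ` (outs (head e) \<inter> A) \<union> dn ` (outs (head e) \<inter> A)"

lemma finite_head_side [simp]: "finite (head_side A e)"
  by (simp add: head_side_def)

lemma card_head_side:
  assumes "inv_except c A u" "e \<in> E" "c (dn e) = None"
  shows "card (head_side A e) \<le> 6 * a - 2"
proof -
  let ?v = "head e"
  have "e \<in> ins ?v" using assms by (auto simp: ins_def)
  then have 1: "card (ins ?v - {e}) = card (ins ?v) - 1" by simp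
  have "card (head_side A e) \<le> card (dn ` (ins ?v - {e})) + card (tp ` (ins ?v - {e})) +
     card (tp ` (outs ?v \<inter> A)) + card (dn ` (outs ?v \<inter> A))"
    unfolding head_side_def by (meson add_mono_thms_linordered_semiring(3) card_Un_le le_trans)
  also have "\<dots> \<le> card (ins ?v - {e}) + card (ins ?v - {e}) + card (outs ?v \<inter> A) + card (outs ?v \<inter> A)"
    by (intro add_mono card_image_le) auto
  \<comment> \<open>Each of the other in-edges (at most \<open>a - 1\<close>) and of the active
    out-edges (at most \<open>2 * a\<close>) contributes two incidences.\<close>
  also have "\<dots> \<le> (a - 1) + (a - 1) + 2 * a + 2 * a"
    using card_out_active_dn[OF assms] card_ins[of ?v] unfolding 1 by linarith
  finally show ?thesis using a_pos by simp
qed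

lemma base_inv_adj_dn:
  assumes "base_inv c A" "e \<in> E" "inc_adj (dn e) j" "c j \<noteq> None"
  shows "j \<in> tp ` outs (tail e) \<union> dn ` ins (tail e) \<union> head_side A e"
proof -
  have "j \<in> incidences E" using assms(1,4) unfolding base_inv_def by blast
  moreover have "j = dn f \<Longrightarrow> f \<in> E \<Longrightarrow> f \<in> A" "j = tp f \<Longrightarrow> f \<in> E \<Longrightarrow> f \<in> A" for f
    using assms(1,4) by (auto simp: base_inv_def dn_col_def tp_col_def)
  ultimately show ?thesis using adj_dn[OF assms(2) _ assms(3)]
    unfolding head_side_def by (auto simp: outs_def)
qed

lemma legal_dn:
  assumes "inv_except c A u" "e \<in> E" "c (dn e) = None"
  shows "\<exists>\<alpha>. legal_move E K c (dn e) \<alpha>"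
proof -
  let ?S = "tp ` outs (tail e) \<union> dn ` ins (tail e) \<union> head_side A e"
  have b: "base_inv c A" using assms by (simp add: inv_except_def)
  have "card (c ` ?S) \<le> card ?S" by (rule card_image_le) simp
  also have "\<dots> \<le> card (tp ` outs (tail e)) + card (dn ` ins (tail e)) + card (head_side A e)"
    by (meson add_mono_thms_linordered_semiring(3) card_Un_le le_trans)
  also have "\<dots> \<le> card (outs (tail e)) + card (ins (tail e)) + (6 * a - 2)"
    using card_head_side[OF assms] by (intro add_mono card_image_le) auto
  also have "\<dots> < K" using card_outs_ins[of "tail e"] K_large a_pos by linarith
  finally have "card (c ` ?S) < K" .
  moreover have "dn e \<in> incidences E" using assms by (simp add: incidences_eq)
  ultimately show ?thesis
    using legal_move_if_few_forbidden[of "dn e" E c "c ` ?S" K] base_inv_adj_dn[OF b assms(2)] assms(3)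
    by simp
qed

text \<open>The head side forbids at most \<open>6 * a - 2\<close> colours, so one of the
  \<open>6 * a - 1\<close> colours on sibling down incidences survives. The tail side cannot forbid
  it, since the sibling carrying it has the same neighbours there.\<close>

lemma legal_dn_reuse:
  assumes "inv_except c A u" "e \<in> E" "c (dn e) = None" "6 * a - 1 \<le> card (dn_colors c (tail e))"
  obtains \<alpha> where "legal_move E K c (dn e) \<alpha>" "Some \<alpha> \<in> dn_colors c (tail e)"
proof -
  have b: "base_inv c A" using assms by (simp add: inv_except_def)
  have "card (c ` head_side A e) \<le> card (head_side A e)" by (rule card_image_le) simp
  also have "\<dots> < 6 * a - 1" using card_head_side[OF assms(1-3)] a_pos by linarith
  also have "\<dots> \<le> card (dn_colors c (tail e))" by (fact assms(4))
  finally have "\<not> dn_colors c (tail e) \<subseteq> c ` head_side A e"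
    using card_mono[of "c ` head_side A e" "dn_colors c (tail e)"] by auto
  then obtain f where f: "f \<in> outs (tail e)" "c (dn f) \<noteq> None" "c (dn f) \<notin> c ` head_side A e"
    by (auto simp: dn_colors_def dn_col_def)
  then obtain \<alpha> where \<alpha>: "c (dn f) = Some \<alpha>" by auto
  have "c j \<noteq> Some \<alpha>" if "inc_adj (dn e) j" for j
  proof
    assume j: "c j = Some \<alpha>"
    then have "j \<in> tp ` outs (tail e) \<union> dn ` ins (tail e)"
      using base_inv_adj_dn[OF b assms(2) that] f(3) \<alpha> by (auto simp: image_iff)
    then have "inc_adj (dn f) j" using adj_dn_dn_parent adj_dn_tp_sibling f(1) by blast
    then show False using b j \<alpha> unfolding base_inv_def proper_coloring_def by (metis option.distinct(1))
  qed
  then have "legal_move E K c (dn e) \<alpha>"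
    using assms(2,3) b \<alpha> unfolding legal_move_def base_inv_def incidences_eq by blast
  moreover have "Some \<alpha> \<in> dn_colors c (tail e)"
    using f \<alpha> by (force simp: dn_colors_def dn_col_def outs_def)
  ultimately show ?thesis using that by blast
qed

text \<open>This count dictates \<open>K\<close>. Writing o and i for the out- and in-degree of the
  tail, at most (6a + o)/2 + (o - 1) + 2i + 3a + (a - 1) colours are forbidden; with o + i bounded
  by \<open>\<Delta>\<close> and i by a, this is at most (3 \<open>\<Delta>\<close> + 15a)/2 -
  2.\<close>

lemma legal_tp:
  assumes "inv_except c A u" "e \<in> E" "c (tp e) = None"
  shows "\<exists>\<alpha>. legal_move E K c (tp e) \<alpha>"
proof -
  let ?u = "tail e" and ?v = "head e"
  let ?S = "tp ` (outs ?u - {e}) \<union> dn ` ins ?u \<union> tp ` ins ?u \<union> tp ` (outs ?v \<inter> A) \<union> dn ` (ins ?v - {e})"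
  let ?X = "c ` ?S \<union> dn_colors c ?u"
  have b: "base_inv c A" using assms by (simp add: inv_except_def)
  have e: "e \<in> outs ?u" "e \<in> ins ?v" using assms by (auto simp: ins_def outs_def)
  \<comment> \<open>The exceptional 1 and the slack are alternatives in \<open>color_inv\<close>, so
    together they cost only 1.\<close>
  have "2 * card (dn_colors c ?u) \<le> 6 * a + card (outs ?u)"
  proof -
    have "color_inv c 1 ?u" using assms(1) by (rule inv_except_slack)
    moreover have "card (outs ?u \<inter> dn_col c) \<le> card (outs ?u)" by (rule card_mono) auto
    ultimately show ?thesis using a_pos unfolding color_inv_def by (auto split: if_splits)
  qed
  moreover have "card (c ` ?S) \<le> (card (outs ?u) - 1) + card (ins ?u) + card (ins ?u) +
      card (outs ?v \<inter> A) + (card (ins ?v) - 1)"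
  proof -
    have "card (c ` ?S) \<le> card ?S" by (rule card_image_le) simp
    also have "\<dots> \<le> card (tp ` (outs ?u - {e})) + card (dn ` ins ?u) + card (tp ` ins ?u) +
        card (tp ` (outs ?v \<inter> A)) + card (dn ` (ins ?v - {e}))"
      by (meson add_mono_thms_linordered_semiring(3) card_Un_le le_trans)
    also have "\<dots> \<le> card (outs ?u - {e}) + card (ins ?u) + card (ins ?u) +
        card (outs ?v \<inter> A) + card (ins ?v - {e})"
      by (intro add_mono card_image_le) auto
    finally show ?thesis using e by simp
  qed
  moreover have "card (outs ?v \<inter> A) \<le> 3 * card (ins ?v)" using card_out_active_tp[OF assms] .
  moreover have "0 < card (outs ?u)" "0 < card (ins ?v)"
    using e by (auto simp: card_gt_0_iff)
  moreover have "card ?X \<le> card (c ` ?S) + card (dn_colors c ?u)" by (rule card_Un_le)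
  ultimately have "card ?X < K"
    using card_outs_ins[of ?u] card_ins[of ?u] card_ins[of ?v] K_large a_pos by linarith
  moreover have "c j \<in> ?X" if "inc_adj (tp e) j" "c j \<noteq> None" for j
  proof -
    have "j \<in> incidences E" using b that unfolding base_inv_def by blast
    moreover have "j = tp f \<Longrightarrow> f \<in> E \<Longrightarrow> f \<in> A" for f
      using b that(2) by (auto simp: base_inv_def tp_col_def)
    moreover have "j = dn f \<Longrightarrow> f \<in> outs ?u \<Longrightarrow> c j \<in> dn_colors c ?u" for f
      using that(2) by (auto simp: dn_colors_def dn_col_def outs_def)
    ultimately show ?thesis using adj_tp[OF assms(2) _ that(1)] by (auto simp: outs_def)
  qed
  moreover have "tp e \<in> incidences E" using assms by (simp add: incidences_eq)
  ultimately show ?thesis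
    using legal_move_if_few_forbidden[of "tp e" E c ?X K] assms(3) by simp
qed

lemma no_blocked_inv_except: "inv_except c A u \<Longrightarrow> no_blocked E K c"
  unfolding no_blocked_def using legal_dn legal_tp by (metis incidence_cases)


section \<open>Alice's strategy\<close>

text \<open>Colouring and activating only enlarge the right-hand sides and weaken the premises; the
  sole cost is the number \<open>t\<close> of newly active out-edges.\<close>

lemma in_inv_mono:
  assumes "in_inv c A s w" "dn_col c \<subseteq> dn_col c'" "tp_col c \<subseteq> tp_col c'" "A \<subseteq> A'"
    and "card (outs w \<inter> A') \<le> card (outs w \<inter> A) + t"
  shows "in_inv c' A' (s + t) w"
proof -
  have "card (ins w \<inter> A) \<le> card (ins w \<inter> A')"
    "card (ins w \<inter> dn_col c) \<le> card (ins w \<inter> dn_col c')"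
    "card (ins w \<inter> tp_col c) \<le> card (ins w \<inter> tp_col c')"
    using assms by (auto intro: card_mono)
  then show ?thesis using assms(1-3,5) unfolding in_inv_def by fastforce
qed

text \<open>A reaction on an in-edge raises a right-hand side by one and so pays off the slack.
  Colouring a top incidence helps only the second inequality, hence the demand that the first one be
  vacuous.\<close>

lemma in_inv_progress:
  assumes "in_inv c A 1 w" "dn_col c \<subseteq> dn_col c'" "tp_col c \<subseteq> tp_col c'" "A \<subseteq> A'"
    and "outs w \<inter> A' = outs w \<inter> A" "e \<in> ins w"
    and "e \<in> A' - A \<or> e \<in> dn_col c' - dn_col c \<or> ins w \<subseteq> dn_col c \<and> e \<in> tp_col c' - tp_col c"
  shows "in_inv c' A' 0 w"
proof -
  have le: "card (ins w \<inter> A) \<le> card (ins w \<inter> A')"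
    "card (ins w \<inter> dn_col c) \<le> card (ins w \<inter> dn_col c')"
    "card (ins w \<inter> tp_col c) \<le> card (ins w \<inter> tp_col c')"
    using assms by (auto intro: card_mono)
  have less: "card (ins w \<inter> X) < card (ins w \<inter> Y)" if "X \<subseteq> Y" "e \<in> Y - X" for X Y
    using that assms(6) by (intro psubset_card_mono) auto
  from assms(7) have "card (ins w \<inter> A) < card (ins w \<inter> A') \<or>
    card (ins w \<inter> dn_col c) < card (ins w \<inter> dn_col c') \<or>
    ins w \<subseteq> dn_col c \<and> card (ins w \<inter> tp_col c) < card (ins w \<inter> tp_col c')"
    using less assms(2-4) by blast
  then show ?thesis using assms(1-3,5) le unfolding in_inv_def by fastforce
qed

lemma in_inv_complete: "ins w \<subseteq> dn_col c \<inter> tp_col c \<Longrightarrow> in_inv c A s w"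
  by (simp add: in_inv_def)

text \<open>Of the two copies of the colour count, one is paid by \<open>6 * a - 1\<close> and the
  other by the coloured down incidences.\<close>

lemma color_inv_few:
  assumes "card (dn_colors c w) \<le> 6 * a - 1"
  shows "color_inv c s w"
  using assms dn_colors_le[of c w] by (auto simp: color_inv_def)

text \<open>While an in-edge of \<open>w\<close> is incomplete, at most \<open>3 * a\<close>
  out-edges are active, and this is at most \<open>6 * a - 1\<close>. The colour bound thus needs
  care only once all in-edges are coloured.\<close>

lemma color_inv_incomplete:
  assumes "base_inv c A" "in_inv c A 1 w" "\<not> ins w \<subseteq> dn_col c \<inter> tp_col c"
  shows "color_inv c s w"
proof (rule color_inv_few)
  have "card (outs w \<inter> dn_col c) \<le> card (outs w \<inter> A)"
    using assms(1) by (intro card_mono) (auto simp: base_inv_def)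
  then show "card (dn_colors c w) \<le> 6 * a - 1"
    using card_out_active_incomplete[OF assms(2,3)] card_ins[of w] a_pos dn_colors_le[of c w] by linarith
qed

lemma color_inv_update_tp: "e \<in> E \<Longrightarrow> color_inv (c(tp e := Some \<alpha>)) s w = color_inv c s w"
  by (simp add: color_inv_def dn_col_update dn_colors_update_tp)

lemma color_inv_update_dn_other:
  "e \<in> E \<Longrightarrow> c (dn e) = None \<Longrightarrow> w \<noteq> tail e \<Longrightarrow> color_inv (c(dn e := Some \<alpha>)) s w = color_inv c s w"
proof -
  assume *: "e \<in> E" "c (dn e) = None" "w \<noteq> tail e"
  then have "e \<notin> outs w" by (simp add: outs_def)
  then show ?thesis using * by (simp add: color_inv_def dn_col_update dn_colors_update_dn subset_insert)
qed

text \<open>The threshold exceeds by one what the head side can forbid, so the required reuse is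
  always possible.\<close>

definition thrifty :: "('a \<times> 'a set \<Rightarrow> nat option) \<Rightarrow> 'a set \<Rightarrow> nat \<Rightarrow> bool" where
  "thrifty c e \<alpha> \<longleftrightarrow> legal_move E K c (dn e) \<alpha> \<and>
     (6 * a - 1 \<le> card (dn_colors c (tail e)) \<longrightarrow> Some \<alpha> \<in> dn_colors c (tail e))"

lemma thrifty_exists:
  assumes "inv_except c A u" "e \<in> E" "c (dn e) = None"
  obtains \<alpha> where "thrifty c e \<alpha>"
  using legal_dn[OF assms] legal_dn_reuse[OF assms] unfolding thrifty_def by metis

lemma card_outs_dn_col_insert:
  assumes "e \<in> E" "c (dn e) = None"
  shows "card (outs (tail e) \<inter> insert e (dn_col c)) = Suc (card (outs (tail e) \<inter> dn_col c))"
proof -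
  have "e \<in> outs (tail e)" "e \<notin> dn_col c" using assms by (auto simp: outs_def dn_col_def)
  then show ?thesis by simp
qed

text \<open>Above the threshold no new colour appears while the number of coloured down incidences
  grows, which pays off the slack. Below it, at most \<open>6 * a - 1\<close> colours
  result.\<close>

lemma color_inv_thrifty:
  assumes "color_inv c 1 w" "e \<in> E" "c (dn e) = None" "thrifty c e \<alpha>" "w = tail e"
  shows "color_inv (c(dn e := Some \<alpha>)) s w"
proof (cases "6 * a - 1 \<le> card (dn_colors c w)")
  case True
  then have "dn_colors (c(dn e := Some \<alpha>)) w = dn_colors c w"
    using assms by (auto simp: thrifty_def dn_colors_update_dn)
  moreover have "2 * card (dn_colors c w) \<le> 6 * a - 1 + card (outs w \<inter> dn_col c) + 1"
    using assms(1) by (auto simp: color_inv_def split: if_splits)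
  ultimately show ?thesis
    using assms by (simp add: color_inv_def dn_col_update card_outs_dn_col_insert)
next
  case False
  then have "card (dn_colors (c(dn e := Some \<alpha>)) w) \<le> 6 * a - 1"
    using assms by (simp add: dn_colors_update_dn card_insert_if)
  then show ?thesis by (rule color_inv_few)
qed

text \<open>A new colour adds 2 on the left but only 1 through the coloured down incidences. The
  missing 1 is the slack, or the exceptional 1 if \<open>e\<close> was the last.\<close>

lemma color_inv_update_dn:
  assumes "color_inv c 0 w" "e \<in> E" "c (dn e) = None"
  shows "color_inv (c(dn e := Some \<alpha>)) (of_bool (w = tail e)) w"
proof (cases "w = tail e")
  case True
  have "card (insert (Some \<alpha>) (dn_colors c w)) \<le> Suc (card (dn_colors c w))"
    by (rule card_insert_le_m1) auto
  moreover have "\<not> outs w \<subseteq> dn_col c" using assms True by (auto simp: outs_def dn_col_def)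
  ultimately show ?thesis using assms True
    by (auto simp: color_inv_def dn_col_update card_outs_dn_col_insert dn_colors_update_dn)
qed (use assms color_inv_update_dn_other in auto)

lemma outs_insert: "e \<in> E \<Longrightarrow> w \<noteq> tail e \<Longrightarrow> outs w \<inter> insert e A = outs w \<inter> A"
  by (auto simp: outs_def)

lemma in_inv_insert:
  assumes "in_inv c A 0 w" "dn_col c \<subseteq> dn_col c'" "tp_col c \<subseteq> tp_col c'" "e \<in> E"
  shows "in_inv c' (insert e A) (of_bool (w = tail e)) w"
proof -
  have "card (outs w \<inter> insert e A) \<le> card (outs w \<inter> A) + of_bool (w = tail e)"
    using outs_insert[OF assms(4), of w A] by (cases "w = tail e") (auto simp: Int_insert_right card_insert_if)
  then show ?thesis using in_inv_mono[OF assms(1-3)] by (metis add_0 subset_insertI)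
qed

text \<open>This is the climbing step: the debt moves to \<open>tail e\<close>. The
  \<open>of_bool\<close> also admits \<open>v\<close> as that tail, for a climb that starts at an
  arbitrary edge.\<close>

lemma inv_activate:
  assumes "base_inv c A" "\<And>w. w \<noteq> v \<Longrightarrow> in_inv c A 0 w" "in_inv c (insert e A) (of_bool (v = tail e)) v"
    "\<And>w. color_inv c 0 w" "e \<in> E"
  shows "inv_except c (insert e A) (tail e)"
  unfolding inv_except_def
proof (intro conjI allI)
  fix w
  show "in_inv c (insert e A) (of_bool (w = tail e)) w"
    using assms(2,3,5) in_inv_insert[of c A w c e] by (cases "w = v") auto
  show "color_inv c (of_bool (w = tail e)) w" using assms(4) color_inv_weaken by blast
qed (use assms base_inv_activate in auto)

lemma bob_move:
  assumes "inv_all c A" "legal_move E K c i \<alpha>"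
  shows "\<exists>A' v. inv_except (c(i := Some \<alpha>)) A' v"
proof -
  have i: "i \<in> incidences E" "c i = None" using assms(2) by (auto simp: legal_move_def)
  from i(1) obtain e where e: "e \<in> E" "i = dn e \<or> i = tp e" by (auto simp: incidences_eq)
  \<comment> \<open>Whichever end Bob colours, only the tail of the edge gains an active out-edge or
    a down colour, so only there is a reaction owed.\<close>
  have "inv_except (c(i := Some \<alpha>)) (insert e A) (tail e)"
    unfolding inv_except_def
  proof (intro conjI allI)
    show "base_inv (c(i := Some \<alpha>)) (insert e A)"
      using assms e base_inv_update by (auto simp: inv_all_def)
    fix w
    have w: "in_inv c A 0 w" "color_inv c 0 w" using assms(1) by (auto simp: inv_all_def)
    show "in_inv (c(i := Some \<alpha>)) (insert e A) (of_bool (w = tail e)) w"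
      using e by (intro in_inv_insert[OF w(1)]) (auto simp: dn_col_update)
    show "color_inv (c(i := Some \<alpha>)) (of_bool (w = tail e)) w"
      using e(2)
    proof
      assume "i = dn e"
      then show ?thesis using color_inv_update_dn[OF w(2) e(1)] i by auto
    next
      assume "i = tp e"
      then show ?thesis using color_inv_update_tp[OF e(1)] color_inv_weaken[OF w(2)] by simp
    qed
  qed
  then show ?thesis by blast
qed

text \<open>The thrifty choice itself repairs the colour bound at \<open>tail e\<close>, so no
  slack-free bound is assumed there.\<close>

lemma inv_all_color_dn:
  assumes "inv_except c A v" "e \<in> E" "c (dn e) = None" "thrifty c e \<alpha>"
    and "\<And>w. in_inv (c(dn e := Some \<alpha>)) (insert e A) 0 w"
    and "\<And>w. w \<noteq> tail e \<Longrightarrow> color_inv c 0 w"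
  shows "inv_all (c(dn e := Some \<alpha>)) (insert e A)"
  unfolding inv_all_def
proof (intro conjI allI)
  show "base_inv (c(dn e := Some \<alpha>)) (insert e A)"
    using assms base_inv_update by (auto simp: inv_except_def thrifty_def)
  fix w
  show "in_inv (c(dn e := Some \<alpha>)) (insert e A) 0 w" by fact
  show "color_inv (c(dn e := Some \<alpha>)) 0 w"
    using assms color_inv_thrifty[OF inv_except_slack(2)[OF assms(1)] assms(2-4)]
    by (cases "w = tail e") (auto simp: color_inv_update_dn_other)
qed

lemma inv_all_color_tp:
  assumes "base_inv c A" "e \<in> E" "legal_move E K c (tp e) \<alpha>"
    and "\<And>w. in_inv (c(tp e := Some \<alpha>)) (insert e A) 0 w" "\<And>w. color_inv c 0 w"
  shows "inv_all (c(tp e := Some \<alpha>)) (insert e A)"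
  unfolding inv_all_def using assms base_inv_update by (auto simp: color_inv_update_tp)

text \<open>Induction on the number of inactive edges: a climbing step activates an edge without
  spending a move, and every other branch colours an incidence.\<close>

lemma alice_move:
  assumes "inv_except c A v" "\<exists>i \<in> incidences E. c i = None"
  shows "\<exists>i \<alpha> A'. legal_move E K c i \<alpha> \<and> inv_all (c(i := Some \<alpha>)) A'"
  using assms(1)
proof (induction "card (E - A)" arbitrary: A v rule: less_induct)
  case less
  note inv = less.prems
  have base: "base_inv c A" using inv by (simp add: inv_except_def)
  have others: "in_inv c A 0 w" "color_inv c 0 w" if "w \<noteq> v" for w
    using inv that unfolding inv_except_def by (metis of_bool_eq(1))+
  note at_v = inv_except_slack[OF inv, of v]
  have activate: ?case if "e \<in> E" "e \<notin> A" "inv_except c (insert e A) (tail e)" for e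
  proof (rule less.hyps[OF _ that(3)])
    show "card (E - insert e A) < card (E - A)"
      using that finite_E by (intro psubset_card_mono) auto
  qed
  have stay: "outs (head e) \<inter> insert e A = outs (head e) \<inter> A" if "e \<in> E" for e
    using that outs_insert tail_neq_head by metis
  \<comment> \<open>The order of the cases is the priority of Alice's reactions at \<open>v\<close>;
    in the last one neither in-edges nor down incidences below \<open>v\<close> are left to work
    on.\<close>
  consider (dn_in) e where "e \<in> ins v" "c (dn e) = None"
    | (tp_in) e where "ins v \<subseteq> dn_col c" "e \<in> ins v" "c (tp e) = None"
    | (dn_out) e where "ins v \<subseteq> dn_col c \<inter> tp_col c" "e \<in> outs v" "c (dn e) = None"
    | (settled) "ins v \<subseteq> dn_col c \<inter> tp_col c" "outs v \<subseteq> dn_col c"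
  proof -
    have "e \<in> dn_col c \<longleftrightarrow> c (dn e) \<noteq> None" "e \<in> tp_col c \<longleftrightarrow> c (tp e) \<noteq> None"
      if "e \<in> ins v \<or> e \<in> outs v" for e
      using that by (auto simp: ins_def outs_def dn_col_def tp_col_def)
    then show ?thesis using that by (metis IntI subsetI)
  qed
  then show ?case
  proof cases
    case dn_in
    then have e: "e \<in> E" "head e = v" "e \<notin> dn_col c" by (auto simp: ins_def dn_col_def)
    then have ne: "tail e \<noteq> v" using tail_neq_head[of e] by simp
    have "color_inv c 0 v" using color_inv_incomplete[OF base at_v(1)] dn_in e by blast
    then have col: "color_inv c 0 w" for w using others by (cases "w = v") auto
    \<comment> \<open>An inactive \<open>e\<close> is only activated: this settles \<open>v\<close>
      and passes the debt to \<open>tail e\<close>. An active one is coloured, which ends the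
      climb.\<close>
    show ?thesis
    proof (cases "e \<in> A")
      case False
      have "in_inv c (insert e A) 0 v"
        using in_inv_progress[OF at_v(1), of c "insert e A" e] False dn_in stay e by auto
      then show ?thesis
        using activate[OF e(1) False] inv_activate[of c A v e] base others col e ne by auto
    next
      case True
      obtain \<alpha> where \<alpha>: "thrifty c e \<alpha>" using thrifty_exists[OF inv e(1) dn_in(2)] by blast
      let ?c = "c(dn e := Some \<alpha>)"
      have "in_inv ?c (insert e A) 0 w" for w
      proof (cases "w = v")
        case True
        then show ?thesis using in_inv_progress[OF at_v(1), of ?c "insert e A" e] dn_in stay e
          by (auto simp: dn_col_update)
      next
        case False
        then show ?thesis using in_inv_mono[OF others(1), of w ?c A 0] True e
          by (auto simp: dn_col_update insert_absorb)
      qed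
      then have "inv_all ?c (insert e A)" using inv_all_color_dn[OF inv e(1) dn_in(2) \<alpha>] col by blast
      then show ?thesis using \<alpha> unfolding thrifty_def by blast
    qed
  next
    case tp_in
    then have e: "e \<in> E" "head e = v" "e \<notin> tp_col c" by (auto simp: ins_def tp_col_def)
    \<comment> \<open>A coloured down incidence has already made \<open>e\<close> active, so
      colouring its top incidence burdens no tail.\<close>
    have "e \<in> A" using tp_in base by (auto simp: base_inv_def)
    have "color_inv c 0 v" using color_inv_incomplete[OF base at_v(1)] tp_in e by blast
    then have col: "color_inv c 0 w" for w using others by (cases "w = v") auto
    obtain \<alpha> where \<alpha>: "legal_move E K c (tp e) \<alpha>" using legal_tp[OF inv e(1) tp_in(3)] by blast
    let ?c = "c(tp e := Some \<alpha>)"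
    have "in_inv ?c (insert e A) 0 w" for w
    proof (cases "w = v")
      case True
      then show ?thesis using in_inv_progress[OF at_v(1), of ?c "insert e A" e] tp_in stay e
        by (auto simp: dn_col_update)
    next
      case False
      then show ?thesis using in_inv_mono[OF others(1), of w ?c A 0] \<open>e \<in> A\<close> e
        by (auto simp: dn_col_update insert_absorb)
    qed
    then have "inv_all ?c (insert e A)" using inv_all_color_tp[OF base e(1) \<alpha>] col by blast
    then show ?thesis using \<alpha> by blast
  next
    case dn_out
    then have e: "e \<in> E" "tail e = v" by (auto simp: outs_def)
    obtain \<alpha> where \<alpha>: "thrifty c e \<alpha>" using thrifty_exists[OF inv e(1) dn_out(3)] by blast
    let ?c = "c(dn e := Some \<alpha>)"
    have "in_inv ?c (insert e A) 0 w" for w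
    proof (cases "w = v")
      case True
      \<comment> \<open>The edge may become active just now, but with all in-edges of
        \<open>v\<close> complete both inequalities are vacuous there.\<close>
      then show ?thesis using in_inv_complete[of v ?c] dn_out e by (auto simp: dn_col_update)
    next
      case False
      then show ?thesis using in_inv_mono[OF others(1), of w ?c "insert e A" 0] outs_insert e
        by (auto simp: dn_col_update)
    qed
    then have "inv_all ?c (insert e A)"
      using inv_all_color_dn[OF inv e(1) dn_out(3) \<alpha>] others e by blast
    then show ?thesis using \<alpha> unfolding thrifty_def by blast
  next
    case settled
    have "in_inv c A 0 v" using settled by (simp add: in_inv_complete)
    then have ii: "in_inv c A 0 w" for w using others by (cases "w = v") auto
    \<comment> \<open>All down incidences below \<open>v\<close> are coloured, so the exceptional 1
      takes the place of the slack.\<close>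
    have "color_inv c 0 v" using at_v(2) settled by (simp add: color_inv_def)
    then have col: "color_inv c 0 w" for w using others by (cases "w = v") auto
    \<comment> \<open>Nothing is owed any more, so any uncoloured incidence serves; if its edge is
      inactive, a new climb starts at its tail.\<close>
    obtain e where e: "e \<in> E" "c (dn e) = None \<or> c (tp e) = None"
      using assms(2) by (auto simp: incidences_eq)
    show ?thesis
    proof (cases "e \<in> A")
      case False
      have "inv_except c (insert e A) (tail e)"
        using inv_activate[of c A v e] in_inv_insert[OF ii] base ii col e by blast
      then show ?thesis using activate e(1) False by blast
    next
      case True
      have ii': "in_inv c' (insert e A) 0 w" if "dn_col c \<subseteq> dn_col c'" "tp_col c \<subseteq> tp_col c'" for c' w
        using in_inv_mono[OF ii that, where t = 0] True by (simp add: insert_absorb)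
      show ?thesis
      proof (cases "c (dn e) = None")
        case True
        obtain \<alpha> where \<alpha>: "thrifty c e \<alpha>" using thrifty_exists[OF inv e(1) True] by blast
        have "inv_all (c(dn e := Some \<alpha>)) (insert e A)"
          using e col by (intro inv_all_color_dn[OF inv e(1) True \<alpha>] ii') (auto simp: dn_col_update)
        then show ?thesis using \<alpha> unfolding thrifty_def by blast
      next
        case False
        then obtain \<alpha> where \<alpha>: "legal_move E K c (tp e) \<alpha>" using legal_tp[OF inv e(1)] e by metis
        have "inv_all (c(tp e := Some \<alpha>)) (insert e A)"
          using e col by (intro inv_all_color_tp[OF base e(1) \<alpha>] ii') (auto simp: dn_col_update)
        then show ?thesis using \<alpha> by blast
      qed
    qed
  qed
qed

section \<open>Playing the game to its end\<close>

lemma num_colored_update: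
  assumes "legal_move E K c i \<alpha>"
  shows "num_colored E (c(i := Some \<alpha>)) = Suc (num_colored E c)"
proof -
  have "{j \<in> incidences E. (c(i := Some \<alpha>)) j \<noteq> None} = insert i {j \<in> incidences E. c j \<noteq> None}"
    "i \<notin> {j \<in> incidences E. c j \<noteq> None}"
    using assms by (auto simp: legal_move_def)
  then show ?thesis using finite_incidences by (simp add: num_colored_def)
qed

lemma num_colored_le: "num_colored E c \<le> card (incidences E)"
  unfolding num_colored_def using finite_incidences by (intro card_mono) auto

text \<open>Induction over rounds: Alice's move removes the debt, and Bob's reply creates one at a
  single vertex.\<close>

lemma alice_wins_inv_except:
  assumes "inv_except c A v" "even (num_colored E c)"
  shows "alice_wins E K c"
  using assms
proof (induction "card (incidences E) - num_colored E c" arbitrary: c A v rule: less_induct)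
  case less
  show ?case
  proof (cases "\<exists>i\<in>incidences E. c i = None")
    case True
    then obtain i \<alpha> A' where i: "legal_move E K c i \<alpha>" and A': "inv_all (c(i := Some \<alpha>)) A'"
      using alice_move less.prems(1) by blast
    let ?c = "c(i := Some \<alpha>)"
    have "alice_wins E K ?c"
    proof (cases "\<exists>i\<in>incidences E. ?c i = None")
      case True
      show ?thesis
      proof (rule alice_wins.bob_turn)
        show "odd (num_colored E ?c)" using num_colored_update[OF i] less.prems(2) by simp
        show "no_blocked E K ?c" using A' inv_all_imp_except no_blocked_inv_except by blast
        show "\<forall>j \<beta>. legal_move E K ?c j \<beta> \<longrightarrow> alice_wins E K (?c(j := Some \<beta>))"
        proof (intro allI impI)
          fix j \<beta> assume j: "legal_move E K ?c j \<beta>"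
          let ?d = "?c(j := Some \<beta>)"
          obtain A'' v' where "inv_except ?d A'' v'" using bob_move[OF A' j] by blast
          moreover have n: "num_colored E ?d = Suc (Suc (num_colored E c))"
            using num_colored_update[OF i] num_colored_update[OF j] by simp
          moreover have "card (incidences E) - num_colored E ?d < card (incidences E) - num_colored E c"
            using n num_colored_le[of ?d] by linarith
          ultimately show "alice_wins E K ?d" using less.hyps less.prems(2) by simp
        qed
      qed (fact True)
    qed (auto intro: alice_wins.finished)
    then show ?thesis
      using alice_wins.alice_turn less.prems no_blocked_inv_except i by blast
  qed (auto intro: alice_wins.finished)
qed

lemma alice_wins_empty: "alice_wins E K (\<lambda>_. None)"
proof (rule alice_wins_inv_except)
  \<comment> \<open>The exceptional vertex is arbitrary: before the first move both counts are zero
    everywhere.\<close>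
  show "inv_except (\<lambda>_. None) {} undefined"
    by (simp add: inv_except_def base_inv_def in_inv_def color_inv_def dn_colors_def
        dn_col_def tp_col_def proper_coloring_def)
qed (simp add: num_colored_def)

end

section \<open>Orienting forests\<close>

lemma forest_subset: "forest F \<Longrightarrow> G \<subseteq> F \<Longrightarrow> forest G"
  unfolding forest_def is_cycle_def by blast

text \<open>If two consecutive edges of a cycle coincide, its vertices 0 and 2 are equal, which its
  length of at least 3 excludes.\<close>

lemma forest_singleton: "forest {e}"
  unfolding forest_def
proof
  assume "\<exists>vs. is_cycle {e} vs"
  then obtain vs where vs: "3 \<le> length vs" "distinct vs"
    "\<And>i. i < length vs \<Longrightarrow> {vs ! i, vs ! ((i + 1) mod length vs)} = e"
    unfolding is_cycle_def by auto
  have "(0 + 1) mod length vs = 1" "(1 + 1) mod length vs = 2" using vs(1) by auto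
  moreover have "{vs ! 0, vs ! ((0 + 1) mod length vs)} = e" "{vs ! 1, vs ! ((1 + 1) mod length vs)} = e"
    by (rule vs(3), use vs(1) in linarith)+
  ultimately have "{vs ! 0, vs ! 1} = {vs ! 1, vs ! 2}" by (simp only:)
  then have "vs ! 0 = vs ! 2" by (auto simp: doubleton_eq_iff)
  moreover have "vs ! 0 \<noteq> vs ! 2" using vs(1,2) by (subst nth_eq_iff_index_eq) auto
  ultimately show False by simp
qed

lemma card_2_other_element: "card e = 2 \<Longrightarrow> x \<in> e \<Longrightarrow> \<exists>y. e = {y, x} \<and> y \<noteq> x"
  by (auto simp: card_2_iff)

text \<open>Without a leaf every path could be extended at its front, since returning to the path
  would close a cycle. Paths of any length contradict finiteness.\<close>

lemma forest_leaf:
  assumes "finite F" "F \<noteq> {}" "\<And>e. e \<in> F \<Longrightarrow> card e = 2" "forest F"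
  shows "\<exists>e\<in>F. \<exists>v\<in>e. \<forall>f\<in>F. v \<in> f \<longrightarrow> f = e"
proof (rule ccontr)
  assume no: "\<not> ?thesis"
  have path: "\<exists>vs. length vs = n + 2 \<and> distinct vs \<and> (\<forall>i < n + 1. {vs ! i, vs ! Suc i} \<in> F)" for n
  proof (induction n)
    case 0
    obtain e where "e \<in> F" using assms(2) by blast
    then obtain x y where "e = {x, y}" "x \<noteq> y" using assms(3) by (meson card_2_iff)
    then show ?case using \<open>e \<in> F\<close> by (intro exI[of _ "[x, y]"]) auto
  next
    case (Suc n)
    then obtain vs where vs: "length vs = n + 2" "distinct vs" "\<And>i. i < n + 1 \<Longrightarrow> {vs ! i, vs ! Suc i} \<in> F"
      by blast
    have "{vs ! 0, vs ! 1} \<in> F" using vs(3)[of 0] by simp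
    then obtain f where f: "f \<in> F" "vs ! 0 \<in> f" "f \<noteq> {vs ! 0, vs ! 1}" using no by blast
    obtain z where z: "f = {z, vs ! 0}" "z \<noteq> vs ! 0"
      using card_2_other_element[OF assms(3)[OF f(1)] f(2)] by blast
    have "z \<notin> set vs"
    proof
      assume "z \<in> set vs"
      then obtain j where j: "j < length vs" "vs ! j = z" by (meson in_set_conv_nth)
      have "j \<noteq> 0" "j \<noteq> 1" using j z f(3) by (auto simp: insert_commute)
      \<comment> \<open>The edge \<open>f\<close> closes the initial segment ending at
        \<open>z\<close>; as \<open>j\<close> is neither 0 nor 1, it has at least three
        vertices.\<close>
      have "is_cycle F (take (j + 1) vs)"
        unfolding is_cycle_def
      proof (intro conjI allI impI)
        show "3 \<le> length (take (j + 1) vs)" using j \<open>j \<noteq> 0\<close> \<open>j \<noteq> 1\<close> by simp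
        show "distinct (take (j + 1) vs)" using vs(2) by simp
        fix i assume "i < length (take (j + 1) vs)"
        then consider "i < j" | "i = j" using j by fastforce
        then show "{take (j + 1) vs ! i, take (j + 1) vs ! ((i + 1) mod length (take (j + 1) vs))} \<in> F"
        proof cases
          case 1
          then show ?thesis using vs(1) vs(3)[of i] j by simp
        next
          case 2
          then show ?thesis using f(1) z(1) j by simp
        qed
      qed
      then show False using assms(4) unfolding forest_def by blast
    qed
    moreover have "{(z # vs) ! i, (z # vs) ! Suc i} \<in> F" if "i < Suc n + 1" for i
      using that f(1) z(1) vs(3)[of "i - 1"] by (cases i) auto
    ultimately show ?case using vs by (intro exI[of _ "z # vs"]) auto
  qed
  have fin: "finite (\<Union> F)"
    using assms(1,3) by (intro finite_Union) (auto intro: card_ge_0_finite)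
  obtain vs where vs: "length vs = card (\<Union> F) + 2" "distinct vs"
    "\<And>i. i < card (\<Union> F) + 1 \<Longrightarrow> {vs ! i, vs ! Suc i} \<in> F"
    using path by blast
  have "set vs \<subseteq> \<Union> F"
  proof
    fix x assume "x \<in> set vs"
    then obtain i where i: "i < length vs" "vs ! i = x" by (meson in_set_conv_nth)
    then show "x \<in> \<Union> F" using vs(1) vs(3)[of i] vs(3)[of "i - 1"]
      by (cases "i < card (\<Union> F) + 1") (auto simp: less_Suc_eq)
  qed
  then have "length vs \<le> card (\<Union> F)"
    using card_mono[OF fin] distinct_card[OF vs(2)] by metis
  then show False using vs(1) by simp
qed

text \<open>An injective choice of an endpoint is an orientation with in-degree at most one: send
  each leaf edge to its leaf.\<close>

lemma forest_inj_endpoint: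
  assumes "finite F" "\<forall>e\<in>F. card e = 2" "forest F"
  shows "\<exists>h. inj_on h F \<and> (\<forall>e\<in>F. h e \<in> e)"
  using assms
proof (induction F rule: finite_psubset_induct)
  case (psubset F)
  show ?case
  proof (cases "F = {}")
    case True
    then show ?thesis by simp
  next
    case False
    then have "\<exists>e\<in>F. \<exists>v\<in>e. \<forall>f\<in>F. v \<in> f \<longrightarrow> f = e"
      using psubset.hyps(1) psubset.prems by (intro forest_leaf) simp_all
    then obtain e v where e: "e \<in> F" "v \<in> e" "\<forall>f\<in>F. v \<in> f \<longrightarrow> f = e" by blast
    have "\<exists>h. inj_on h (F - {e}) \<and> (\<forall>f\<in>F - {e}. h f \<in> f)"
    proof (rule psubset.IH)
      show "F - {e} \<subset> F" using e(1) by blast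
      show "\<forall>e\<in>F - {e}. card e = 2" using psubset.prems(1) by simp
      show "forest (F - {e})" using psubset.prems(2) by (rule forest_subset) simp
    qed
    then obtain h where h: "inj_on h (F - {e})" "\<forall>f\<in>F - {e}. h f \<in> f" by blast
    have v: "h f \<noteq> v" if "f \<in> F" "f \<noteq> e" for f
      using h(2) e(3) that by (metis DiffI singletonD)
    have "inj_on (h(e := v)) F"
    proof (rule inj_onI)
      fix x y assume xy: "x \<in> F" "y \<in> F" "(h(e := v)) x = (h(e := v)) y"
      show "x = y"
      proof (cases "x = e \<or> y = e")
        case True
        then show ?thesis using xy v[of x] v[of y] by (auto split: if_splits)
      next
        case False
        then show ?thesis using xy inj_onD[OF h(1), of x y] by simp
      qed
    qed
    moreover have "\<forall>f\<in>F. (h(e := v)) f \<in> f" using h(2) e(2) by simp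
    ultimately show ?thesis by (intro exI[of _ "h(e := v)"] conjI)
  qed
qed

section \<open>Orientation along an optimal forest partition\<close>

text \<open>Putting each edge into a class of its own shows that some number of forests suffices, so
  the \<open>LEAST\<close> in \<open>arboricity\<close> is attained.\<close>

lemma arboricity_partition:
  assumes "finite E"
  shows "\<exists>f :: 'a set \<Rightarrow> nat. (\<forall>e\<in>E. f e < arboricity E) \<and> (\<forall>j<arboricity E. forest {e\<in>E. f e = j})"
proof -
  let ?P = "\<lambda>k. \<exists>f :: 'a set \<Rightarrow> nat. (\<forall>e\<in>E. f e < k) \<and> (\<forall>j<k. forest {e\<in>E. f e = j})"
  obtain f where f: "bij_betw f E {0..<card E}"
    using ex_bij_betw_finite_nat[OF assms] by blast
  have "forest {e \<in> E. f e = j}" if "j < card E" for j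
  proof -
    have "j \<in> f ` E" using f that by (simp add: bij_betw_def)
    then obtain e where e: "e \<in> E" "j = f e" by (rule imageE)
    then have "{d \<in> E. f d = j} \<subseteq> {e}" using inj_onD[OF bij_betw_imp_inj_on[OF f]] by auto
    then show ?thesis by (rule forest_subset[OF forest_singleton])
  qed
  moreover have "f e < card E" if "e \<in> E" for e
    using bij_betwE[OF f] that by simp
  ultimately have "?P (card E)" by (intro exI[of _ f]) auto
  then show ?thesis unfolding arboricity_def by (rule LeastI[of ?P])
qed

lemma arboricity_orientation:
  assumes "finite E" "\<And>e. e \<in> E \<Longrightarrow> card e = 2"
  shows "\<exists>head. (\<forall>e\<in>E. head e \<in> e) \<and> (\<forall>v. card {e \<in> E. head e = v} \<le> arboricity E)"
proof -
  obtain f :: "'a set \<Rightarrow> nat" where f: "\<And>e. e \<in> E \<Longrightarrow> f e < arboricity E"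
    "\<And>j. j < arboricity E \<Longrightarrow> forest {e \<in> E. f e = j}"
    using arboricity_partition[OF assms(1)] by blast
  have "\<exists>h. j < arboricity E \<longrightarrow> inj_on h {e \<in> E. f e = j} \<and> (\<forall>e\<in>{e \<in> E. f e = j}. h e \<in> e)" for j
  proof (cases "j < arboricity E")
    case True
    then show ?thesis using assms f(2)[OF True] forest_inj_endpoint[of "{e \<in> E. f e = j}"] by simp
  qed simp
  then obtain h where "\<forall>j. j < arboricity E \<longrightarrow>
      inj_on (h j) {e \<in> E. f e = j} \<and> (\<forall>e\<in>{e \<in> E. f e = j}. h j e \<in> e)"
    using choice[of "\<lambda>j h. j < arboricity E \<longrightarrow>
      inj_on h {e \<in> E. f e = j} \<and> (\<forall>e\<in>{e \<in> E. f e = j}. h e \<in> e)"] by blast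
  then have h: "\<And>j. j < arboricity E \<Longrightarrow> inj_on (h j) {e \<in> E. f e = j}"
    "\<And>e. e \<in> E \<Longrightarrow> h (f e) e \<in> e"
    using f(1) by simp_all
  define head where "head e = h (f e) e" for e
  have "card {e \<in> E. head e = v} \<le> arboricity E" for v
  proof -
    \<comment> \<open>Each forest contributes at most one in-edge of \<open>v\<close>, so the
      in-edges are counted by their forests.\<close>
    have "inj_on f {e \<in> E. head e = v}"
    proof (rule inj_onI)
      fix d e assume "d \<in> {e \<in> E. head e = v}" "e \<in> {e \<in> E. head e = v}" "f d = f e"
      then show "d = e" using inj_onD[OF h(1)[OF f(1)[of e]], of d e] by (simp add: head_def)
    qed
    moreover have "f ` {e \<in> E. head e = v} \<subseteq> {..<arboricity E}" using f(1) by auto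
    ultimately have "card {e \<in> E. head e = v} \<le> card {..<arboricity E}" by (rule card_inj_on_le) simp
    then show ?thesis by simp
  qed
  moreover have "\<forall>e\<in>E. head e \<in> e" using h(2) by (simp add: head_def)
  ultimately show ?thesis by blast
qed

section \<open>The bound on the incidence game chromatic number\<close>

theorem theorem2:
  fixes V :: "'a set" and E :: "'a set set"
  assumes "simple_graph V E" and "E \<noteq> {}"
  shows "int (incidence_game_chromatic E)
           \<le> floor ((3 * real (max_degree V E) - real (arboricity E)) / 2)
              + 8 * int (arboricity E) - 1"
proof -
  have V: "finite V" "\<And>e. e \<in> E \<Longrightarrow> e \<subseteq> V" "\<And>e. e \<in> E \<Longrightarrow> card e = 2"
    using assms(1) by (auto simp: simple_graph_def)
  have finE: "finite E" using V(1,2) by (meson Pow_iff finite_Pow_iff finite_subset subsetI)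
  obtain head where head: "\<And>e. e \<in> E \<Longrightarrow> head e \<in> e" "\<And>v. card {e \<in> E. head e = v} \<le> arboricity E"
    using arboricity_orientation[OF finE V(3)] by blast
  have "\<exists>t. e = {t, head e} \<and> t \<noteq> head e" if "e \<in> E" for e
    using card_2_other_element[OF V(3)[OF that] head(1)[OF that]] .
  then obtain tail where tail: "\<And>e. e \<in> E \<Longrightarrow> e = {tail e, head e} \<and> tail e \<noteq> head e" by metis
  have a_pos: "1 \<le> arboricity E"
  proof -
    obtain e where "e \<in> E" using assms(2) by blast
    then show ?thesis using arboricity_partition[OF finE] by force
  qed
  have deg: "card {e \<in> E. v \<in> e} \<le> max_degree V E" for v
  proof (cases "v \<in> V")
    case True
    then show ?thesis using V(1) by (simp add: max_degree_def flip: degree_def)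
  next
    case False
    then have "{e \<in> E. v \<in> e} = {}" using V(2) by blast
    then show ?thesis by (metis card.empty le0)
  qed
  define m where "m = (3 * int (max_degree V E) - int (arboricity E)) div 2"
  have floor: "floor ((3 * real (max_degree V E) - real (arboricity E)) / 2) = m"
    using floor_divide_of_int_eq[of "3 * int (max_degree V E) - int (arboricity E)" 2, where ?'a = real]
    by (simp add: m_def)
  \<comment> \<open>The integer is nonnegative because the arboricity is at least 1, so
    \<open>nat\<close> does not truncate.\<close>
  define K where "K = nat (m + 8 * int (arboricity E) - 1)"
  have K: "int K = m + 8 * int (arboricity E) - 1" using a_pos unfolding K_def m_def by linarith
  \<comment> \<open>Doubling \<open>m\<close> loses at most 1 to rounding; with the 2 from the
    doubled \<open>- 1\<close> this gives the 3 on the right.\<close>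
  have "3 * max_degree V E + 15 * arboricity E \<le> 2 * K + 3" using K unfolding m_def by linarith
  then interpret bounded_orientation E head tail "arboricity E" "max_degree V E" K
    using finE tail head(2) deg a_pos by unfold_locales auto
  have "incidence_game_chromatic E \<le> K"
    unfolding incidence_game_chromatic_def by (rule Least_le) (rule alice_wins_empty)
  then show ?thesis using K floor by linarith
qed

end
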